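(* Let $M$ be a positive integer. There exists an equal norm tight integer frame with $M+1$ elements in $\mathcal{H}_M$ if and only if $M+1$ is the sum of $1$, $2$, $4$, or $8$ odd squares.
   Context: $\mathcal{H}_M$ is the real $M$-dimensional Hilbert space, identified with $\mathbb{R}^M$ via a fixed orthonormal basis. An equal norm tight integer frame (ENTIF) with $N$ elements in $\mathcal{H}_M$ is an $M\times N$ integer matrix $A$ of rank $M$ with $AA^T=\lambda I_M$ for some $\lambda>0$ and all columns of the same Euclidean norm. *)

theory Defs
  imports Complex_Main
begin

text \<open>An M x N integer matrix is represented as a function A :: nat => nat => int,
  where only the entries A i j with i < M and j < N are relevant.\<close>

definition has_rank_rows :: "nat \<Rightarrow> nat \<Rightarrow> (nat \<Rightarrow> nat \<Rightarrow> int) \<Rightarrow> bool" where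
  "has_rank_rows M N A \<longleftrightarrow>
     (\<forall>c :: nat \<Rightarrow> real. (\<forall>j<N. (\<Sum>i<M. c i * real_of_int (A i j)) = 0) \<longrightarrow> (\<forall>i<M. c i = 0))"

definition ENTIF :: "nat \<Rightarrow> nat \<Rightarrow> (nat \<Rightarrow> nat \<Rightarrow> int) \<Rightarrow> bool" where
  "ENTIF M N A \<longleftrightarrow>
     has_rank_rows M N A \<and>
     (\<exists>lam::real. lam > 0 \<and>
        (\<forall>i<M. \<forall>k<M. (\<Sum>j<N. real_of_int (A i j * A k j)) = (if i = k then lam else 0))) \<and>
     (\<forall>j<N. \<forall>j'<N. (\<Sum>i<M. (A i j)\<^sup>2) = (\<Sum>i<M. (A i j')\<^sup>2))"

definition sum_of_odd_squares :: "nat \<Rightarrow> nat \<Rightarrow> bool" where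
  "sum_of_odd_squares k n \<longleftrightarrow>
     (\<exists>x :: nat \<Rightarrow> int. (\<forall>i<k. odd (x i)) \<and> int n = (\<Sum>i<k. (x i)\<^sup>2))"

end

theory Submission
  imports Defs "HOL-Computational_Algebra.Primes" "Jordan_Normal_Form.Determinant"
begin

text \<open>
  Write N = M + 1. The kernel of an equal norm tight frame A with N elements is spanned by a vector
  u with entries 1 and -1, so adjoining the row u to A gives a square rational matrix with
  orthogonal rows, of squared norms \<lambda> (M times) and N. Its determinant shows that N is a square
  if N is odd, and that \<lambda> N is a rational square if N is even. In the latter case A can be rescaled
  to give a rational matrix C with C C^T = N I; if N = 2 mod 4, the cancellation argument of
  Bruck and Ryser turns this into a representation of N as a sum of two rational, hence two
  integer, squares. If 4 divides N, Lagrange's theorem makes N a sum of four or eight odd squares.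

  Conversely, if N is a sum of d = 1, 2 or 4 squares and d divides N, copies of the matrix of
  multiplication by a real, complex or quaternion number of norm N on the diagonal give an integer
  matrix B with B B^T = N I. A Householder reflection moves the first row of B to the all-ones vector,
  and the other rows, cleared of denominators, form the frame. Eight odd squares sum to a multiple
  of 8, so that case reduces to d = 4 by Lagrange's theorem.
\<close>

section \<open>Sums of squares\<close>

lemma sum_lessThan_2: "(\<Sum>i<2. f i) = f 0 + f 1" for f :: "nat \<Rightarrow> 'a::comm_monoid_add"
  by (simp add: eval_nat_numeral)

lemma sum_lessThan_4: "(\<Sum>i<4. f i) = f 0 + f 1 + f 2 + f 3"
  for f :: "nat \<Rightarrow> 'a::comm_monoid_add"
  by (simp add: eval_nat_numeral)

lemma all_less_2: "(\<forall>i<2. P i) \<longleftrightarrow> P 0 \<and> P (1::nat)"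
  by (auto simp: less_Suc_eq numeral_eq_Suc)

lemma all_less_4: "(\<forall>i<4. P i) \<longleftrightarrow> P 0 \<and> P 1 \<and> P 2 \<and> P (3::nat)"
  by (auto simp: less_Suc_eq numeral_eq_Suc)

section \<open>Lagrange's four-square theorem\<close>

definition sum_of_four_squares :: "int \<Rightarrow> bool" where
  "sum_of_four_squares n \<longleftrightarrow> (\<exists>a b c d. n = a\<^sup>2 + b\<^sup>2 + c\<^sup>2 + d\<^sup>2)"

text \<open>The quaternion norm is multiplicative. The signs are those of a product with a
  conjugate: if \<open>e, f, g, h\<close> are congruent to \<open>a, b, c, d\<close> modulo some m,
  the last three brackets vanish modulo m and the first becomes a sum of four squares, as the
  descent requires.\<close>

lemma euler_four_squares:
  fixes a b c d e f g h :: "'a::comm_ring_1"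
  shows "(a\<^sup>2 + b\<^sup>2 + c\<^sup>2 + d\<^sup>2) * (e\<^sup>2 + f\<^sup>2 + g\<^sup>2 + h\<^sup>2) =
    (a*e + b*f + c*g + d*h)\<^sup>2 + (a*f - b*e + c*h - d*g)\<^sup>2 +
    (a*g - c*e + d*f - b*h)\<^sup>2 + (a*h - d*e + b*g - c*f)\<^sup>2"
  by (simp add: power2_eq_square algebra_simps)

lemma sum_of_four_squares_mult:
  assumes "sum_of_four_squares m" "sum_of_four_squares n"
  shows "sum_of_four_squares (m * n)"
  using assms unfolding sum_of_four_squares_def using euler_four_squares by blast

lemma centered_residue:
  fixes x m :: int
  assumes "m > 0"
  obtains y k where "x = y + m * k" "- m < 2 * y" "2 * y \<le> m"
proof (cases "2 * (x mod m) \<le> m")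
  case True
  show ?thesis
  proof (rule that)
    show "x = x mod m + m * (x div m)" by simp
    show "- m < 2 * (x mod m)"
      using assms pos_mod_sign[of m x] by linarith
  qed (fact True)
next
  case False
  have "x mod m < m" using assms by simp
  show ?thesis
  proof (rule that)
    have "x = x mod m + m * (x div m)" by simp
    thus "x = (x mod m - m) + m * (x div m + 1)" by (simp add: algebra_simps)
  qed (use False \<open>x mod m < m\<close> in auto)
qed

lemma square_le_of_centered:
  fixes y m :: int
  assumes "- m < 2 * y" "2 * y \<le> m"
  shows "4 * y\<^sup>2 \<le> m\<^sup>2"
proof -
  have "\<bar>2 * y\<bar> \<le> \<bar>m\<bar>" using assms by linarith
  hence "(2 * y)\<^sup>2 \<le> m\<^sup>2" by (rule abs_le_square_iff[THEN iffD1])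
  thus ?thesis by (simp add: power_mult_distrib)
qed

text \<open>Pigeonhole: for \<open>p = 2 * h + 1\<close> and arguments from 0 to \<open>h\<close>,
  the numbers \<open>a\<^sup>2\<close> and \<open>- 1 - b\<^sup>2\<close> each take
  \<open>h + 1\<close> residues, too many to be disjoint. The size bound later makes the cofactor of
  \<open>p\<close> smaller than \<open>p\<close>.\<close>

lemma odd_prime_dvd_sum_of_squares_plus_one:
  fixes p :: int
  assumes "prime p" "odd p"
  obtains a b where "p dvd a\<^sup>2 + b\<^sup>2 + 1" "a\<^sup>2 + b\<^sup>2 + 1 < p\<^sup>2"
proof -
  define h where "h = p div 2"
  have p: "p = 2 * h + 1" using assms(2) unfolding h_def by presburger
  have p2: "p \<ge> 2" using assms(1) prime_ge_2_int by blast
  hence h: "h \<ge> 1" using p by simp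
  have sq_inj: "a = b" if "a \<in> {0..h}" "b \<in> {0..h}" "p dvd a\<^sup>2 - b\<^sup>2" for a b
  proof -
    have "p dvd (a - b) * (a + b)" using that(3) by (simp add: power2_eq_square algebra_simps)
    then consider "p dvd a - b" | "p dvd a + b"
      using assms(1) prime_dvd_mult_iff by blast
    thus ?thesis
    proof cases
      case 1
      have "\<bar>a - b\<bar> < p" using that p by auto
      hence "a - b = 0" using 1 dvd_imp_le_int[of "a - b" p] by auto
      thus ?thesis by simp
    next
      case 2
      have "a + b = 0"
      proof (rule ccontr)
        assume "a + b \<noteq> 0"
        hence "p \<le> a + b" using that 2 zdvd_imp_le[of p "a + b"] by auto
        thus False using that p by auto
      qed
      thus ?thesis using that by auto
    qed
  qed
  define X where "X = (\<lambda>a. a\<^sup>2 mod p) ` {0..h}"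
  define Y where "Y = (\<lambda>b. (- 1 - b\<^sup>2) mod p) ` {0..h}"
  have "inj_on (\<lambda>a. a\<^sup>2 mod p) {0..h}"
    by (rule inj_onI) (metis mod_eq_dvd_iff sq_inj)
  hence cX: "card X = nat (h + 1)" unfolding X_def by (simp add: card_image)
  have "inj_on (\<lambda>b. (- 1 - b\<^sup>2) mod p) {0..h}"
  proof (rule inj_onI)
    fix a b assume ab: "a \<in> {0..h}" "b \<in> {0..h}" "(- 1 - a\<^sup>2) mod p = (- 1 - b\<^sup>2) mod p"
    hence "p dvd (- 1 - a\<^sup>2) - (- 1 - b\<^sup>2)" by (simp add: mod_eq_dvd_iff)
    hence "p dvd b\<^sup>2 - a\<^sup>2" by simp
    thus "a = b" using sq_inj[of b a] ab by simp
  qed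
  hence cY: "card Y = nat (h + 1)" unfolding Y_def by (simp add: card_image)
  have "X \<inter> Y \<noteq> {}"
  proof
    assume "X \<inter> Y = {}"
    hence "card (X \<union> Y) = nat (h + 1) + nat (h + 1)"
      using cX cY by (subst card_Un_disjoint) (auto simp: X_def Y_def)
    moreover have "card (X \<union> Y) \<le> card {0..<p}"
      using p2 by (intro card_mono) (auto simp: X_def Y_def)
    ultimately show False using p h by simp
  qed
  then obtain a b where ab: "a \<in> {0..h}" "b \<in> {0..h}" "a\<^sup>2 mod p = (- 1 - b\<^sup>2) mod p"
    unfolding X_def Y_def by blast
  hence "p dvd a\<^sup>2 + b\<^sup>2 + 1" by (simp add: mod_eq_dvd_iff algebra_simps)
  moreover have "a\<^sup>2 + b\<^sup>2 + 1 < p\<^sup>2"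
  proof -
    have "a\<^sup>2 \<le> h\<^sup>2" "b\<^sup>2 \<le> h\<^sup>2" using ab by (auto intro: power_mono)
    moreover have "p\<^sup>2 = 4 * h\<^sup>2 + 4 * h + 1" unfolding p by (simp add: power2_eq_square algebra_simps)
    moreover have "h\<^sup>2 \<ge> 0" by simp
    ultimately show ?thesis using h by linarith
  qed
  ultimately show ?thesis by (rule that)
qed

text \<open>The centered residues modulo \<open>m\<close> of the four roots have squares summing to
  \<open>m * r\<close> with \<open>r \<le> m\<close>. Multiplying by Euler's identity gives four
  brackets divisible by \<open>m\<close>, so \<open>m\<^sup>2\<close> cancels. The extremes
  \<open>r = 0\<close> and \<open>r = m\<close> would make \<open>m * m\<close> divide
  \<open>m * p\<close>, impossible for a prime \<open>p\<close> with
  \<open>1 < m < p\<close>.\<close>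

lemma sum_of_four_squares_descent:
  fixes p m :: int
  assumes "prime p" "1 < m" "m < p" "sum_of_four_squares (m * p)"
  obtains r where "0 < r" "r < m" "sum_of_four_squares (r * p)"
proof -
  obtain a b c d where s: "m * p = a\<^sup>2 + b\<^sup>2 + c\<^sup>2 + d\<^sup>2"
    using assms(4) unfolding sum_of_four_squares_def by blast
  have m: "m > 0" using assms by simp
  have nd: "\<not> m * m dvd m * p"
  proof
    assume "m * m dvd m * p"
    hence "m dvd p" using m by simp
    thus False using assms(1-3) m by (metis less_imp_le less_irrefl prime_int_iff)
  qed
  obtain e k1 where e: "a = e + m * k1" "- m < 2 * e" "2 * e \<le> m" using centered_residue[OF m] .
  obtain f k2 where f: "b = f + m * k2" "- m < 2 * f" "2 * f \<le> m" using centered_residue[OF m] .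
  obtain g k3 where g: "c = g + m * k3" "- m < 2 * g" "2 * g \<le> m" using centered_residue[OF m] .
  obtain h k4 where h: "d = h + m * k4" "- m < 2 * h" "2 * h \<le> m" using centered_residue[OF m] .
  \<comment> \<open>The quotient of \<open>e\<^sup>2 + f\<^sup>2 + g\<^sup>2 + h\<^sup>2\<close> by
    \<open>m\<close>, found by expanding \<open>s\<close> with \<open>a = e + m * k1\<close> and its
    analogues.\<close>
  define r where "r = p - 2 * (e * k1 + f * k2 + g * k3 + h * k4) - m * (k1\<^sup>2 + k2\<^sup>2 + k3\<^sup>2 + k4\<^sup>2)"
  have r: "m * r = e\<^sup>2 + f\<^sup>2 + g\<^sup>2 + h\<^sup>2"
    using s unfolding r_def e(1) f(1) g(1) h(1) by (simp add: power2_eq_square algebra_simps)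
  note sq = square_le_of_centered[OF e(2,3)] square_le_of_centered[OF f(2,3)]
    square_le_of_centered[OF g(2,3)] square_le_of_centered[OF h(2,3)]
  have "m * r \<ge> 0" unfolding r by simp
  hence r0: "r \<ge> 0" using m by (simp add: zero_le_mult_iff)
  have "4 * (m * r) \<le> 4 * m\<^sup>2" unfolding r using sq by simp
  hence rm: "r \<le> m" using m by (simp add: power2_eq_square)
  have "r \<noteq> 0"
  proof
    assume "r = 0"
    hence "e\<^sup>2 + f\<^sup>2 + g\<^sup>2 + h\<^sup>2 = 0" using r by simp
    hence "e\<^sup>2 = 0" "f\<^sup>2 = 0" "g\<^sup>2 = 0" "h\<^sup>2 = 0"
      using zero_le_power2[of e] zero_le_power2[of f] zero_le_power2[of g] zero_le_power2[of h]
      by linarith+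
    hence "m * p = m * m * (k1\<^sup>2 + k2\<^sup>2 + k3\<^sup>2 + k4\<^sup>2)"
      using s e f g h by (simp add: power2_eq_square algebra_simps)
    thus False using nd by (metis dvd_triv_left)
  qed
  moreover have "r \<noteq> m"
  proof
    assume "r = m"
    hence "4 * e\<^sup>2 + 4 * f\<^sup>2 + 4 * g\<^sup>2 + 4 * h\<^sup>2 = 4 * m\<^sup>2" using r by (simp add: power2_eq_square)
    hence *: "4 * e\<^sup>2 = m\<^sup>2" "4 * f\<^sup>2 = m\<^sup>2" "4 * g\<^sup>2 = m\<^sup>2" "4 * h\<^sup>2 = m\<^sup>2" using sq by linarith+
    \<comment> \<open>A centered residue is never -m/2, so extremal squares force all four residues
      to equal +m/2.\<close>
    have half: "m = 2 * y" if "4 * y\<^sup>2 = m\<^sup>2" "- m < 2 * y" for y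
    proof -
      have "(2 * y)\<^sup>2 = m\<^sup>2" using that by (simp add: power_mult_distrib)
      thus ?thesis using that(2) unfolding power2_eq_iff by auto
    qed
    have "m = 2 * e" "m = 2 * f" "m = 2 * g" "m = 2 * h" using half * e f g h by blast+
    hence "f = e" "g = e" "h = e" "m = 2 * e" by simp_all
    hence "m * p = m * m * (1 + k1 + k2 + k3 + k4 + k1\<^sup>2 + k2\<^sup>2 + k3\<^sup>2 + k4\<^sup>2)"
      using s unfolding e(1) f(1) g(1) h(1) by (simp add: power2_eq_square algebra_simps)
    thus False using nd by (metis dvd_triv_left)
  qed
  moreover have "sum_of_four_squares (r * p)"
  proof -
    \<comment> \<open>The quotients by \<open>m\<close> of the four brackets in Euler's
      identity.\<close>
    define z1 where "z1 = p - (a*k1 + b*k2 + c*k3 + d*k4)"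
    define z2 where "z2 = b*k1 - a*k2 + d*k3 - c*k4"
    define z3 where "z3 = c*k1 - a*k3 + b*k4 - d*k2"
    define z4 where "z4 = d*k1 - a*k4 + c*k2 - b*k3"
    have z1: "a*e + b*f + c*g + d*h = m * z1"
    proof -
      have "m * z1 = a\<^sup>2 + b\<^sup>2 + c\<^sup>2 + d\<^sup>2 - m * (a*k1 + b*k2 + c*k3 + d*k4)"
        unfolding z1_def using s by (simp add: algebra_simps)
      thus ?thesis unfolding e(1) f(1) g(1) h(1) by (simp add: power2_eq_square algebra_simps)
    qed
    have z2: "a*f - b*e + c*h - d*g = m * z2" and z3: "a*g - c*e + d*f - b*h = m * z3"
      and z4: "a*h - d*e + b*g - c*f = m * z4"
      unfolding z2_def z3_def z4_def e(1) f(1) g(1) h(1) by (simp_all add: algebra_simps)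
    have "m\<^sup>2 * (r * p) = (m * p) * (m * r)" by (simp add: power2_eq_square)
    also have "\<dots> = (m * z1)\<^sup>2 + (m * z2)\<^sup>2 + (m * z3)\<^sup>2 + (m * z4)\<^sup>2"
      unfolding s r euler_four_squares z1 z2 z3 z4 ..
    also have "\<dots> = m\<^sup>2 * (z1\<^sup>2 + z2\<^sup>2 + z3\<^sup>2 + z4\<^sup>2)"
      by (simp add: power_mult_distrib algebra_simps)
    finally have "r * p = z1\<^sup>2 + z2\<^sup>2 + z3\<^sup>2 + z4\<^sup>2" using m by simp
    thus ?thesis unfolding sum_of_four_squares_def by blast
  qed
  ultimately show ?thesis using r0 rm by (intro that[of r]) auto
qed

lemma sum_of_four_squares_prime:
  fixes p :: int
  assumes "prime p"
  shows "sum_of_four_squares p"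
proof (cases "odd p")
  case False
  hence "p = 2" using assms primes_dvd_imp_eq[of 2 p] by simp
  hence "p = 1\<^sup>2 + 1\<^sup>2 + 0\<^sup>2 + 0\<^sup>2" by simp
  thus ?thesis unfolding sum_of_four_squares_def by blast
next
  case True
  have p: "p > 0" using assms prime_gt_0_int by blast
  have *: "sum_of_four_squares p"
    if "0 < m" "m < p" "sum_of_four_squares (m * p)" for m
    using that
  proof (induction "nat m" arbitrary: m rule: less_induct)
    case less
    show ?case
    proof (cases "m = 1")
      case False
      hence "1 < m" using less by simp
      then obtain r where r: "0 < r" "r < m" "sum_of_four_squares (r * p)"
        using sum_of_four_squares_descent[OF assms _ less(3,4)] by blast
      show ?thesis using less(1)[of r] r less by simp
    qed (use less in simp)
  qed
  obtain a b where ab: "p dvd a\<^sup>2 + b\<^sup>2 + 1" "a\<^sup>2 + b\<^sup>2 + 1 < p\<^sup>2"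
    using odd_prime_dvd_sum_of_squares_plus_one[OF assms True] .
  then obtain m where m: "a\<^sup>2 + b\<^sup>2 + 1 = p * m" by blast
  have "m * p = a\<^sup>2 + b\<^sup>2 + 1\<^sup>2 + 0\<^sup>2" using m by simp
  hence "sum_of_four_squares (m * p)" unfolding sum_of_four_squares_def by blast
  moreover have "p * m < p * p" using ab(2) m by (simp add: power2_eq_square)
  hence "m < p" using p by simp
  moreover have "p * m > 0" unfolding m[symmetric] by (simp add: add_nonneg_pos)
  hence "m > 0" using p by (simp add: zero_less_mult_iff)
  ultimately show ?thesis using * by blast
qed

theorem lagrange_four_squares: "sum_of_four_squares (int n)"
proof (induction n rule: less_induct)
  case (less n)
  consider "n = 0" | "n = 1" | "n > 1" by linarith
  thus ?case
  proof cases
    case 1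
    hence "int n = 0\<^sup>2 + 0\<^sup>2 + 0\<^sup>2 + 0\<^sup>2" by simp
    thus ?thesis unfolding sum_of_four_squares_def by blast
  next
    case 2
    hence "int n = 1\<^sup>2 + 0\<^sup>2 + 0\<^sup>2 + 0\<^sup>2" by simp
    thus ?thesis unfolding sum_of_four_squares_def by blast
  next
    case 3
    then obtain p where p: "prime p" "p dvd n" using prime_factor_nat[of n] by auto
    then obtain m where m: "n = p * m" by blast
    have "m < n" using m 3 prime_gt_1_nat[OF p(1)] by (cases "m = 0") auto
    thus ?thesis
      using sum_of_four_squares_mult[OF sum_of_four_squares_prime less(1)[of m], of "int p"] p m by simp
  qed
qed

section \<open>From rational to integral sums of two squares\<close>

text \<open>The descent of Aubry and of Davenport and Cassels on the common denominator
  \<open>t\<close>. It succeeds in the plane because a nearest lattice point is at squared distance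
  at most 1/2, which is less than 1.\<close>

lemma sum_of_two_squares_if_rational:
  fixes n t a b :: int
  assumes "t > 0" "n * t\<^sup>2 = a\<^sup>2 + b\<^sup>2"
  shows "\<exists>x y :: int. n = x\<^sup>2 + y\<^sup>2"
  using assms
proof (induction "nat t" arbitrary: t a b rule: less_induct)
  case less
  note t = less(2) and s = less(3)
  obtain \<alpha> x where a: "a = \<alpha> + t * x" "- t < 2 * \<alpha>" "2 * \<alpha> \<le> t" using centered_residue[OF t] .
  obtain \<beta> y where b: "b = \<beta> + t * y" "- t < 2 * \<beta>" "2 * \<beta> \<le> t" using centered_residue[OF t] .
  \<comment> \<open>The line through the rational point (a/t, b/t) and the nearby lattice point (x, y) meets the
    circle of squared radius n in a second point, whose denominator t' is smaller than t.\<close>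
  define u where "u = x\<^sup>2 + y\<^sup>2 - n"
  define v where "v = 2 * (n * t - (a * x + b * y))"
  define t' where "t' = u * t + v"
  have tt': "t * t' = \<alpha>\<^sup>2 + \<beta>\<^sup>2"
  proof -
    have "t * t' = t\<^sup>2 * (x\<^sup>2 + y\<^sup>2) + n * t\<^sup>2 - 2 * t * (a * x + b * y)"
      unfolding t'_def u_def v_def by (simp add: power2_eq_square algebra_simps)
    also have "\<dots> = \<alpha>\<^sup>2 + \<beta>\<^sup>2"
      unfolding s a(1) b(1) by (simp add: power2_eq_square algebra_simps)
    finally show ?thesis .
  qed
  have "4 * (t * t') \<le> 2 * t\<^sup>2"
    unfolding tt' using square_le_of_centered[OF a(2,3)] square_le_of_centered[OF b(2,3)] by simp
  hence "4 * (t * t') < 4 * (t * t)" using t by (simp add: power2_eq_square)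
  hence lt: "t' < t" using t by simp
  have "t * t' \<ge> 0" unfolding tt' by simp
  hence "t' \<ge> 0" using t by (simp add: zero_le_mult_iff)
  show ?case
  proof (cases "t' = 0")
    case True
    hence "\<alpha> = 0" "\<beta> = 0" using tt' by (simp_all add: sum_power2_eq_zero_iff)
    hence "n * t\<^sup>2 = (x\<^sup>2 + y\<^sup>2) * t\<^sup>2"
      using s a b by (simp add: power2_eq_square algebra_simps)
    hence "n = x\<^sup>2 + y\<^sup>2" using t by simp
    thus ?thesis by blast
  next
    case False
    have "(u * a + v * x)\<^sup>2 + (u * b + v * y)\<^sup>2 =
      u\<^sup>2 * (a\<^sup>2 + b\<^sup>2) + u * v * (2 * (a * x + b * y)) + v\<^sup>2 * (x\<^sup>2 + y\<^sup>2)"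
      by (simp add: power2_eq_square algebra_simps)
    also have "2 * (a * x + b * y) = 2 * n * t - v" unfolding v_def by simp
    also have "x\<^sup>2 + y\<^sup>2 = u + n" unfolding u_def by simp
    also have "u\<^sup>2 * (a\<^sup>2 + b\<^sup>2) + u * v * (2 * n * t - v) + v\<^sup>2 * (u + n) = n * t'\<^sup>2"
      unfolding t'_def s[symmetric] by (simp add: power2_eq_square algebra_simps)
    finally have "n * t'\<^sup>2 = (u * a + v * x)\<^sup>2 + (u * b + v * y)\<^sup>2" ..
    thus ?thesis
      using less(1)[of t' "u * a + v * x" "u * b + v * y"] lt t False \<open>t' \<ge> 0\<close> by simp
  qed
qed

section \<open>Sums of odd squares\<close>

text \<open>A Hadamard matrix of order 4 is applied to a Lagrange representation of
  \<open>n\<close>: it multiplies the squared norm by 4, and all new coordinates have the parity of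
  \<open>a + b + c + d\<close>, hence of \<open>n\<close>.\<close>

lemma four_odd_squares:
  assumes "odd n"
  obtains a b c d :: int where "odd a" "odd b" "odd c" "odd d" "4 * int n = a\<^sup>2 + b\<^sup>2 + c\<^sup>2 + d\<^sup>2"
proof -
  obtain a b c d :: int where s: "int n = a\<^sup>2 + b\<^sup>2 + c\<^sup>2 + d\<^sup>2"
    using lagrange_four_squares sum_of_four_squares_def by blast
  have "odd (a + b + c + d)"
  proof -
    have "odd (a\<^sup>2 + b\<^sup>2 + c\<^sup>2 + d\<^sup>2)" using assms s by (metis even_of_nat_iff)
    thus ?thesis by simp
  qed
  hence "odd (a + b + c + d)" "odd (a + b - c - d)" "odd (a - b + c - d)" "odd (a - b - c + d)"
    by simp_all
  moreover have "4 * int n = (a + b + c + d)\<^sup>2 + (a + b - c - d)\<^sup>2 + (a - b + c - d)\<^sup>2 + (a - b - c + d)\<^sup>2"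
    unfolding s by (simp add: power2_eq_square algebra_simps)
  ultimately show ?thesis by (rule that)
qed

lemma sum_of_odd_squares_add:
  assumes "sum_of_odd_squares k m" "sum_of_odd_squares l n"
  shows "sum_of_odd_squares (k + l) (m + n)"
proof -
  obtain x y where x: "\<forall>i<k. odd (x i)" "int m = (\<Sum>i<k. (x i)\<^sup>2)"
    and y: "\<forall>i<l. odd (y i)" "int n = (\<Sum>i<l. (y i)\<^sup>2)"
    using assms unfolding sum_of_odd_squares_def by blast
  define z where "z i = (if i < k then x i else y (i - k))" for i
  have "(\<Sum>i<k + l. (z i)\<^sup>2) = (\<Sum>i<k. (z i)\<^sup>2) + (\<Sum>i<l. (z (k + i))\<^sup>2)"
    by (induction l) simp_all
  also have "\<dots> = int (m + n)" using x y by (simp add: z_def)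
  finally have "int (m + n) = (\<Sum>i<k + l. (z i)\<^sup>2)" ..
  moreover have "\<forall>i<k + l. odd (z i)" using x y by (simp add: z_def)
  ultimately show ?thesis unfolding sum_of_odd_squares_def by blast
qed

lemma sum_of_odd_squares_4:
  assumes "odd n"
  shows "sum_of_odd_squares 4 (4 * n)"
proof -
  obtain a b c d :: int where s: "odd a" "odd b" "odd c" "odd d" "4 * int n = a\<^sup>2 + b\<^sup>2 + c\<^sup>2 + d\<^sup>2"
    using four_odd_squares[OF assms] .
  have "\<forall>i<4. odd ([a,b,c,d] ! i)"
    using s(1-4) by (simp add: all_less_4)
  moreover have "(\<Sum>i<4. ([a,b,c,d] ! i)\<^sup>2) = a\<^sup>2 + b\<^sup>2 + c\<^sup>2 + d\<^sup>2"
    by (simp add: sum_lessThan_4)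
  hence "int (4 * n) = (\<Sum>i<4. ([a,b,c,d] ! i)\<^sup>2)" using s(5) by simp
  ultimately show ?thesis unfolding sum_of_odd_squares_def by blast
qed

lemma sum_of_odd_squares_8:
  assumes "n > 0"
  shows "sum_of_odd_squares 8 (8 * n)"
proof -
  \<comment> \<open>Both \<open>1\<close> and \<open>2 * n - 1\<close> are odd, so each summand is a
    sum of four odd squares.\<close>
  have "sum_of_odd_squares (4 + 4) (4 * 1 + 4 * (2 * n - 1))"
    using assms by (intro sum_of_odd_squares_add sum_of_odd_squares_4) auto
  moreover have "4 * 1 + 4 * (2 * n - 1) = 8 * n" using assms by simp
  ultimately show ?thesis by simp
qed

section \<open>Matrices with orthogonal rows\<close>

text \<open>The weights vary by row because the row adjoined to a frame need not have the norm of
  the others. The ring is left open since integer, rational and real matrices all occur.\<close>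

definition orthogonal_rows ::
    "nat \<Rightarrow> nat \<Rightarrow> (nat \<Rightarrow> 'a) \<Rightarrow> (nat \<Rightarrow> nat \<Rightarrow> 'a::comm_ring_1) \<Rightarrow> bool" where
  "orthogonal_rows m n w B \<longleftrightarrow>
     (\<forall>i<m. \<forall>k<m. (\<Sum>j<n. B i j * B k j) = (if i = k then w i else 0))"

lemma orthogonal_rowsD:
  assumes "orthogonal_rows m n w B" "i < m" "k < m"
  shows "(\<Sum>j<n. B i j * B k j) = (if i = k then w i else 0)"
  using assms unfolding orthogonal_rows_def by blast

lemma orthogonal_rows_of_int:
  assumes "orthogonal_rows m n w B"
  shows "orthogonal_rows m n (\<lambda>i. of_int (w i)) (\<lambda>i j. of_int (B i j))"
  unfolding orthogonal_rows_def
proof (intro allI impI)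
  fix i k assume "i < m" "k < m"
  have "(\<Sum>j<n. of_int (B i j) * of_int (B k j)) = of_int (\<Sum>j<n. B i j * B k j)" by simp
  also have "\<dots> = (if i = k then of_int (w i) else 0)"
    using orthogonal_rowsD[OF assms \<open>i < m\<close> \<open>k < m\<close>] by simp
  finally show "(\<Sum>j<n. of_int (B i j) * of_int (B k j)) = (if i = k then of_int (w i) else 0)" .
qed

text \<open>Pythagoras for a combination of the rows: the cross terms vanish.\<close>

lemma orthogonal_rows_norm:
  assumes "orthogonal_rows m n w B"
  shows "(\<Sum>j<n. (\<Sum>i<m. y i * B i j)\<^sup>2) = (\<Sum>i<m. w i * (y i)\<^sup>2)"
proof -
  have "(\<Sum>j<n. (\<Sum>i<m. y i * B i j)\<^sup>2) = (\<Sum>j<n. \<Sum>i<m. \<Sum>k<m. y i * y k * (B i j * B k j))"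
    by (simp add: power2_eq_square sum_product algebra_simps)
  also have "\<dots> = (\<Sum>i<m. \<Sum>k<m. \<Sum>j<n. y i * y k * (B i j * B k j))"
    by (subst sum.swap) (intro sum.cong refl sum.swap)
  also have "\<dots> = (\<Sum>i<m. \<Sum>k<m. if i = k then w i * (y i)\<^sup>2 else 0)"
  proof (intro sum.cong refl)
    fix i k assume "i \<in> {..<m}" "k \<in> {..<m}"
    thus "(\<Sum>j<n. y i * y k * (B i j * B k j)) = (if i = k then w i * (y i)\<^sup>2 else 0)"
      using orthogonal_rowsD[OF assms, of i k]
      by (simp add: sum_distrib_left[symmetric] power2_eq_square algebra_simps)
  qed
  also have "\<dots> = (\<Sum>i<m. w i * (y i)\<^sup>2)" by (intro sum.cong refl) simp
  finally show ?thesis .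
qed

text \<open>Dividing the columns of the transpose by the weights gives a right inverse of a square
  matrix, which is therefore also a left inverse.\<close>

lemma orthogonal_rows_imp_columns:
  fixes B :: "nat \<Rightarrow> nat \<Rightarrow> 'a::field"
  assumes "orthogonal_rows n n w B" "\<And>i. i < n \<Longrightarrow> w i \<noteq> 0" "j < n" "l < n"
  shows "(\<Sum>i<n. B i j * B i l / w i) = (if j = l then 1 else 0)"
proof -
  define P where "P = mat n n (\<lambda>(i, j). B i j)"
  define Q where "Q = mat n n (\<lambda>(j, i). B i j / w i)"
  have PQ: "P \<in> carrier_mat n n" "Q \<in> carrier_mat n n" unfolding P_def Q_def by auto
  have "P * Q = 1\<^sub>m n"
  proof (rule eq_matI)
    fix i k assume ik: "i < dim_row (1\<^sub>m n)" "k < dim_col (1\<^sub>m n)"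
    hence "(P * Q) $$ (i, k) = (\<Sum>j<n. B i j * B k j) / w k"
      by (simp add: P_def Q_def scalar_prod_def sum_divide_distrib atLeast0LessThan)
    thus "(P * Q) $$ (i, k) = 1\<^sub>m n $$ (i, k)"
      using orthogonal_rowsD[OF assms(1), of i k] assms(2) ik by simp
  qed (use PQ in auto)
  hence "Q * P = 1\<^sub>m n" using mat_mult_left_right_inverse PQ by blast
  hence "(Q * P) $$ (j, l) = (if j = l then 1 else 0)" using assms by simp
  moreover have "(Q * P) $$ (j, l) = (\<Sum>i<n. B i j * B i l / w i)"
    using assms by (simp add: P_def Q_def scalar_prod_def atLeast0LessThan)
  ultimately show ?thesis by simp
qed

lemma orthogonal_rows_transpose:
  fixes B :: "nat \<Rightarrow> nat \<Rightarrow> 'a::field"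
  assumes "orthogonal_rows n n (\<lambda>_. c) B" "c \<noteq> 0"
  shows "orthogonal_rows n n (\<lambda>_. c) (\<lambda>i j. B j i)"
  unfolding orthogonal_rows_def
proof (intro allI impI)
  fix j l assume "j < n" "l < n"
  hence "(\<Sum>i<n. B i j * B i l) / c = (if j = l then 1 else 0)"
    using orthogonal_rows_imp_columns[OF assms(1)] assms(2) by (simp add: sum_divide_distrib)
  thus "(\<Sum>i<n. B i j * B i l) = (if j = l then c else 0)"
    using assms(2) by (auto simp: field_simps split: if_splits)
qed

lemma orthogonal_rows_det:
  fixes B :: "nat \<Rightarrow> nat \<Rightarrow> 'a::comm_ring_1"
  assumes "orthogonal_rows n n w B"
  shows "(det (mat n n (\<lambda>(i, j). B i j)))\<^sup>2 = (\<Prod>i<n. w i)"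
proof -
  define P where "P = mat n n (\<lambda>(i, j). B i j)"
  define W where "W = mat n n (\<lambda>(i, j). if i = j then w i else 0)"
  have P: "P \<in> carrier_mat n n" "P\<^sup>T \<in> carrier_mat n n" unfolding P_def by auto
  have W: "W \<in> carrier_mat n n" unfolding W_def by auto
  have "P * P\<^sup>T = W"
  proof (rule eq_matI)
    fix i k assume ik: "i < dim_row W" "k < dim_col W"
    hence "(P * P\<^sup>T) $$ (i, k) = (\<Sum>j<n. B i j * B k j)"
      by (simp add: P_def W_def scalar_prod_def atLeast0LessThan)
    thus "(P * P\<^sup>T) $$ (i, k) = W $$ (i, k)"
      using orthogonal_rowsD[OF assms, of i k] ik by (simp add: W_def)
  qed (use P W in auto)
  hence "(det P)\<^sup>2 = det W"
    using det_mult[OF P] det_transpose[OF P(1)] by (simp add: power2_eq_square)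
  also have "\<dots> = prod_list (diag_mat W)"
    by (rule det_upper_triangular[OF _ W]) (auto simp: W_def)
  also have "\<dots> = (\<Prod>i<n. w i)"
    unfolding prod_list_diag_prod by (simp add: W_def atLeast0LessThan)
  finally show ?thesis unfolding P_def .
qed

section \<open>Block diagonal matrices from sums of one, two or four squares\<close>

lemma sum_block: "(\<Sum>j<d * m. f j) = (\<Sum>b<m. \<Sum>r<d. f (b * d + r))"
  for f :: "nat \<Rightarrow> 'a::comm_monoid_add"
proof -
  have "(\<Sum>j<m * d. f j) = (\<Sum>b<m. sum f {b * d..<b * d + d})" by (simp add: sum.nat_group)
  also have "\<dots> = (\<Sum>b<m. \<Sum>r<d. f (b * d + r))"
    by (subst sum.atLeastLessThan_shift_0) (simp add: atLeast0LessThan)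
  finally show ?thesis by (simp add: mult.commute)
qed

text \<open>Copies of \<open>Q\<close> along the diagonal: the quotient by \<open>d\<close> names
  the block and the remainder the position in it. Rows from different blocks have disjoint
  supports.\<close>

lemma orthogonal_rows_block:
  assumes "orthogonal_rows d d (\<lambda>_. c) Q"
  shows "orthogonal_rows (d * m) (d * m) (\<lambda>_. c)
    (\<lambda>i j. if i div d = j div d then Q (i mod d) (j mod d) else 0)"
    (is "orthogonal_rows _ _ _ ?B")
  unfolding orthogonal_rows_def
proof (intro allI impI)
  fix i k assume ik: "i < d * m" "k < d * m"
  hence d: "d > 0" by (cases d) auto
  have im: "i div d < m" using ik by (simp add: less_mult_imp_div_less mult.commute)
  have "(\<Sum>j<d * m. ?B i j * ?B k j) = (\<Sum>b<m. \<Sum>r<d. ?B i (b * d + r) * ?B k (b * d + r))"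
    by (rule sum_block)
  also have "\<dots> = (\<Sum>b<m. if b = i div d then
      (if i div d = k div d then \<Sum>r<d. Q (i mod d) r * Q (k mod d) r else 0) else 0)"
    using d by (intro sum.cong refl) auto
  also have "\<dots> = (if i div d = k div d then \<Sum>r<d. Q (i mod d) r * Q (k mod d) r else 0)"
    using im by simp
  also have "\<dots> = (if i div d = k div d \<and> i mod d = k mod d then c else 0)"
    using d by (subst orthogonal_rowsD[OF assms]) auto
  also have "(i div d = k div d \<and> i mod d = k mod d) = (i = k)"
    by (metis div_mult_mod_eq)
  finally show "(\<Sum>j<d * m. ?B i j * ?B k j) = (if i = k then c else 0)" .
qed

lemma orthogonal_rows_one_square:
  fixes a :: "'a::comm_ring_1"
  assumes "c = a\<^sup>2"
  shows "orthogonal_rows 1 1 (\<lambda>_. c) (\<lambda>_ _. a)"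
  using assms by (simp add: orthogonal_rows_def power2_eq_square)

lemma orthogonal_rows_two_squares:
  fixes a b :: "'a::comm_ring_1"
  assumes "c = a\<^sup>2 + b\<^sup>2"
  shows "orthogonal_rows 2 2 (\<lambda>_. c) (\<lambda>i j. [[a, b], [- b, a]] ! i ! j)"
  using assms
  by (simp add: orthogonal_rows_def all_less_2 sum_lessThan_2 power2_eq_square algebra_simps)

text \<open>The rows are the coordinates of q, iq, jq, kq for the quaternion q = a + bi + cj +
  dk.\<close>

lemma orthogonal_rows_four_squares:
  fixes a b c d :: "'a::comm_ring_1"
  assumes "s = a\<^sup>2 + b\<^sup>2 + c\<^sup>2 + d\<^sup>2"
  shows "orthogonal_rows 4 4 (\<lambda>_. s)
    (\<lambda>i j. [[a, b, c, d], [- b, a, - d, c], [- c, d, a, - b], [- d, - c, b, a]] ! i ! j)"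
  using assms
  by (simp add: orthogonal_rows_def all_less_4 sum_lessThan_4 power2_eq_square algebra_simps)

text \<open>The size and \<open>n\<close> are independent. The construction of frames takes
  \<open>n = 4 * m\<close>, the cancellation argument \<open>n = 4 * m + 2\<close>.\<close>

lemma ex_orthogonal_rows_4_dvd:
  obtains B :: "nat \<Rightarrow> nat \<Rightarrow> int" where "orthogonal_rows (4 * m) (4 * m) (\<lambda>_. int n) B"
proof -
  obtain a b c d where "int n = a\<^sup>2 + b\<^sup>2 + c\<^sup>2 + d\<^sup>2"
    using lagrange_four_squares sum_of_four_squares_def by blast
  thus ?thesis using that orthogonal_rows_block[OF orthogonal_rows_four_squares] by blast
qed

section \<open>The Bruck-Ryser cancellation argument\<close>

text \<open>Each equation may be met with either sign, so variables can be eliminated one by one: x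
  = ax + h is solvable unless a = 1, and then x = -(x + h) is, as 2 is invertible. The affine terms
  absorb what elimination leaves.\<close>

lemma ex_solution_squares_eq_affine_squares:
  fixes a :: "nat \<Rightarrow> nat \<Rightarrow> 'a::field_char_0" and b :: "nat \<Rightarrow> 'a"
  shows "\<exists>x. \<forall>i<n. (x i)\<^sup>2 = ((\<Sum>j<n. a i j * x j) + b i)\<^sup>2"
proof (induction n arbitrary: a b)
  case 0
  show ?case by simp
next
  case (Suc n)
  \<comment> \<open>The last equation can be solved for the last variable for at least one choice of sign.\<close>
  define \<kappa> where "\<kappa> = (if a n n = 1 then - 1 / 2 else 1 / (1 - a n n))"
  obtain x where x: "\<forall>i<n. (x i)\<^sup>2 =
      ((\<Sum>j<n. (a i j + a i n * \<kappa> * a n j) * x j) + (b i + a i n * \<kappa> * b n))\<^sup>2"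
    using Suc.IH[of "\<lambda>i j. a i j + a i n * \<kappa> * a n j" "\<lambda>i. b i + a i n * \<kappa> * b n"] by blast
  define h where "h = (\<Sum>j<n. a n j * x j) + b n"
  define x' where "x' = x(n := \<kappa> * h)"
  have s: "(\<Sum>j<Suc n. a i j * x' j) + b i = (\<Sum>j<n. a i j * x j) + b i + a i n * \<kappa> * h" for i
    by (simp add: x'_def)
  have "(x' i)\<^sup>2 = ((\<Sum>j<Suc n. a i j * x' j) + b i)\<^sup>2" if "i < Suc n" for i
  proof (cases "i = n")
    case False
    have "(\<Sum>j<n. (a i j + a i n * \<kappa> * a n j) * x j) + (b i + a i n * \<kappa> * b n) =
        (\<Sum>j<n. a i j * x j) + b i + a i n * \<kappa> * h"
      by (simp add: h_def sum.distrib sum_distrib_left algebra_simps)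
    moreover have "(x i)\<^sup>2 =
        ((\<Sum>j<n. (a i j + a i n * \<kappa> * a n j) * x j) + (b i + a i n * \<kappa> * b n))\<^sup>2"
      using x False that by simp
    moreover have "x' i = x i" using False by (simp add: x'_def)
    ultimately show ?thesis unfolding s by (simp only:)
  next
    case True
    have "(\<kappa> * h)\<^sup>2 = (h + a n n * \<kappa> * h)\<^sup>2"
    proof (cases "a n n = 1")
      case 1: True
      hence "h + a n n * \<kappa> * h = - (\<kappa> * h)" by (simp add: \<kappa>_def)
      thus ?thesis by simp
    next
      case 2: False
      hence "h + a n n * \<kappa> * h = \<kappa> * h" by (simp add: \<kappa>_def field_simps)
      thus ?thesis by simp
    qed
    thus ?thesis unfolding True s by (simp add: x'_def h_def)
  qed
  thus ?case by blast
qed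

lemma rational_square_imp_int_square:
  fixes q :: rat
  assumes "of_int n = q\<^sup>2"
  obtains z :: int where "n = z\<^sup>2"
proof -
  obtain a b where q: "q = of_int a / of_int b" "b > 0"
    by (metis Fract_of_int_quotient Rat_cases)
  hence "(of_int (n * b\<^sup>2) :: rat) = of_int (a\<^sup>2)"
    using assms by (simp add: power_divide)
  hence eq: "n * b\<^sup>2 = a\<^sup>2" by (simp only: of_int_eq_iff)
  hence "b\<^sup>2 dvd a\<^sup>2" by (metis dvd_triv_right)
  then obtain z where "a = b * z" by auto
  hence "n = z\<^sup>2" using eq q(2) by (simp add: power_mult_distrib)
  thus ?thesis by (rule that)
qed

lemma rational_two_squares_imp_int_two_squares:
  fixes p q :: rat
  assumes "of_int n = p\<^sup>2 + q\<^sup>2"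
  obtains x y :: int where "n = x\<^sup>2 + y\<^sup>2"
proof -
  obtain a b where p: "p = of_int a / of_int b" "b > 0"
    by (metis Fract_of_int_quotient Rat_cases)
  obtain c d where q: "q = of_int c / of_int d" "d > 0"
    by (metis Fract_of_int_quotient Rat_cases)
  have "(of_int (n * (b * d)\<^sup>2) :: rat) = of_int ((a * d)\<^sup>2 + (c * b)\<^sup>2)"
    using assms p q by (simp add: field_simps)
  hence "n * (b * d)\<^sup>2 = (a * d)\<^sup>2 + (c * b)\<^sup>2" by (simp only: of_int_eq_iff)
  thus ?thesis using sum_of_two_squares_if_rational[of "b * d" n] p q that by auto
qed

lemma orthogonal_rows_imp_two_rational_squares:
  fixes C :: "nat \<Rightarrow> nat \<Rightarrow> rat"
  assumes C: "orthogonal_rows n n (\<lambda>_. of_nat n) C" and n: "n = 4 * k + 2"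
  obtains p q :: rat where "of_nat n = p\<^sup>2 + q\<^sup>2"
proof -
  obtain B' :: "nat \<Rightarrow> nat \<Rightarrow> int" where B': "orthogonal_rows (4 * k) (4 * k) (\<lambda>_. int n) B'"
    using ex_orthogonal_rows_4_dvd .
  define B :: "nat \<Rightarrow> nat \<Rightarrow> rat" where "B i j = of_int (B' i j)" for i j
  have B: "orthogonal_rows (4 * k) (4 * k) (\<lambda>_. of_nat n) B"
    using orthogonal_rows_of_int[OF B'] by (simp add: B_def[abs_def])
  define K where "K = 4 * k"
  note B = B[folded K_def]
  have n': "n = Suc (Suc K)" using n by (simp add: K_def)
  have n0: "(of_nat n :: rat) \<noteq> 0" using n by simp
  \<comment> \<open>In the variables y, the form n * (sum of the first K squares of x) becomes a plain sum of
    squares. The values of K linear forms can be matched up to sign with y, and what remains is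
    n = (L K)^2 + (L (K + 1))^2.\<close>
  define a where "a i l = (\<Sum>j<K. C i j * B l j) / of_nat n" for i l
  obtain y where y: "\<And>i. i < K \<Longrightarrow> (y i)\<^sup>2 = ((\<Sum>l<K. a i l * y l) + C i K)\<^sup>2"
    using ex_solution_squares_eq_affine_squares[of K a "\<lambda>i. C i K"] by blast
  \<comment> \<open>The first \<open>K\<close> coordinates invert the substitution to
    \<open>y\<close>. Coordinate \<open>K\<close> is set to 1, which produces the affine term
    \<open>C i K\<close>, and the last one to 0.\<close>
  define x where "x j = (if j < K then (\<Sum>i<K. y i * B i j) / of_nat n else if j = K then 1 else 0)" for j
  define L where "L i = (\<Sum>j<n. x j * C i j)" for i
  have L: "L i = (\<Sum>l<K. a i l * y l) + C i K" for i
  proof -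
    have "L i = (\<Sum>j<K. x j * C i j) + C i K" unfolding L_def n' by (simp add: x_def)
    also have "(\<Sum>j<K. x j * C i j) = (\<Sum>j<K. \<Sum>l<K. y l * B l j * C i j / of_nat n)"
      by (intro sum.cong refl) (simp add: x_def sum_distrib_right sum_divide_distrib)
    also have "\<dots> = (\<Sum>l<K. \<Sum>j<K. y l * B l j * C i j / of_nat n)" by (rule sum.swap)
    also have "\<dots> = (\<Sum>l<K. a i l * y l)"
      by (simp add: a_def sum_distrib_left sum_divide_distrib algebra_simps)
    finally show ?thesis .
  qed
  \<comment> \<open>The forms \<open>L i\<close> combine columns of \<open>C\<close>, which are
    orthogonal by transposition.\<close>
  have "(\<Sum>i<n. (L i)\<^sup>2) = of_nat n * (\<Sum>j<n. (x j)\<^sup>2)"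
    unfolding L_def orthogonal_rows_norm[OF orthogonal_rows_transpose[OF C n0]]
    by (simp add: sum_distrib_left)
  also have "(\<Sum>j<n. (x j)\<^sup>2) = (\<Sum>j<K. (x j)\<^sup>2) + 1" unfolding n' by (simp add: x_def)
  also have "(\<Sum>j<K. (x j)\<^sup>2) = (\<Sum>j<K. (\<Sum>i<K. y i * B i j)\<^sup>2) / (of_nat n)\<^sup>2"
    unfolding sum_divide_distrib by (intro sum.cong refl) (simp add: x_def power_divide)
  also have "\<dots> = (\<Sum>i<K. (y i)\<^sup>2) / of_nat n"
    unfolding orthogonal_rows_norm[OF B] using n0
    by (simp add: sum_distrib_left[symmetric] power2_eq_square)
  also have "of_nat n * ((\<Sum>i<K. (y i)\<^sup>2) / of_nat n + 1) = (\<Sum>i<K. (L i)\<^sup>2) + of_nat n"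
    using n0 y by (simp add: L distrib_left)
  also have "(\<Sum>i<n. (L i)\<^sup>2) = (\<Sum>i<K. (L i)\<^sup>2) + (L K)\<^sup>2 + (L (Suc K))\<^sup>2"
    unfolding n' by simp
  finally have "of_nat n = (L K)\<^sup>2 + (L (Suc K))\<^sup>2" by simp
  thus ?thesis by (rule that)
qed

section \<open>Householder reflection to a constant row\<close>

text \<open>Reflection along w = (row 0) - (1, ..., 1), multiplied by the squared norm S of w to stay integral.\<close>

lemma householder_to_constant_row:
  fixes B :: "nat \<Rightarrow> nat \<Rightarrow> int"
  assumes B: "orthogonal_rows n n (\<lambda>_. int n) B" and n: "n > 0"
  obtains d B' where "d \<noteq> 0" "\<And>j. j < n \<Longrightarrow> B' 0 j = d"
    "orthogonal_rows n n (\<lambda>_. d\<^sup>2 * int n) B'"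
proof -
  define w where "w j = B 0 j - 1" for j
  define S where "S = (\<Sum>j<n. w j * w j)"
  define s where "s i = (\<Sum>j<n. B i j * w j)" for i
  show ?thesis
  proof (cases "S = 0")
    case True
    hence "w j = 0" if "j < n" for j using that by (simp add: S_def sum_nonneg_eq_0_iff)
    hence "B 0 j = 1" if "j < n" for j using that by (simp add: w_def)
    thus ?thesis using that[of 1 B] B by simp
  next
    case False
    define B' where "B' i j = S * B i j - 2 * s i * w j" for i j
    have r: "(\<Sum>j<n. B 0 j * B 0 j) = int n" using orthogonal_rowsD[OF B n n] by simp
    \<comment> \<open>Row 0 and the all-ones vector have the same squared norm \<open>n\<close>, so
      \<open>S\<close> is twice the inner product of row 0 with \<open>w\<close>. The scaled
      reflection thus sends row 0 to \<open>S\<close> times the all-ones vector.\<close>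
    have "S = (\<Sum>j<n. B 0 j * B 0 j) - 2 * (\<Sum>j<n. B 0 j) + int n"
      by (simp add: S_def w_def algebra_simps sum.distrib sum_subtractf sum_distrib_left)
    moreover have "s 0 = (\<Sum>j<n. B 0 j * B 0 j) - (\<Sum>j<n. B 0 j)"
      by (simp add: s_def w_def algebra_simps sum_subtractf)
    ultimately have "S = 2 * s 0" using r by simp
    hence row0: "B' 0 j = S" for j
      by (simp add: B'_def w_def algebra_simps)
    have "(\<Sum>j<n. B' i j * B' k j) = S\<^sup>2 * (\<Sum>j<n. B i j * B k j)" for i k
    proof -
      have "B' i j * B' k j = S\<^sup>2 * (B i j * B k j) - 2 * S * s k * (B i j * w j)
          - 2 * S * s i * (B k j * w j) + 4 * s i * s k * (w j * w j)" for j
        by (simp add: B'_def power2_eq_square algebra_simps)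
      hence "(\<Sum>j<n. B' i j * B' k j) = S\<^sup>2 * (\<Sum>j<n. B i j * B k j) - 2 * S * s k * s i
          - 2 * S * s i * s k + 4 * s i * s k * S"
        by (simp add: sum.distrib sum_subtractf sum_distrib_left[symmetric] s_def[symmetric] S_def[symmetric])
      thus ?thesis by simp
    qed
    hence "orthogonal_rows n n (\<lambda>_. S\<^sup>2 * int n) B'"
      using B by (simp add: orthogonal_rows_def)
    thus ?thesis using that[of S B'] False row0 by simp
  qed
qed

section \<open>Frames\<close>

text \<open>After the reflection all columns still have equal norm, and dropping the constant row
  lowers each squared norm by the same \<open>d\<^sup>2\<close>. The rank follows from
  Pythagoras.\<close>

lemma ENTIF_if_orthogonal_rows:
  fixes B :: "nat \<Rightarrow> nat \<Rightarrow> int"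
  assumes M: "M \<ge> 1" and B: "orthogonal_rows (M + 1) (M + 1) (\<lambda>_. int (M + 1)) B"
  shows "\<exists>A. ENTIF M (M + 1) A"
proof -
  obtain d B' where d: "d \<noteq> 0" and row0: "\<And>j. j < M + 1 \<Longrightarrow> B' 0 j = d"
    and B': "orthogonal_rows (M + 1) (M + 1) (\<lambda>_. d\<^sup>2 * int (M + 1)) B'"
    using householder_to_constant_row[OF B] by auto
  define c where "c = d\<^sup>2 * int (M + 1)"
  have c: "c > 0" using d by (simp add: c_def)
  note B' = B'[folded c_def]
  define A where "A i j = B' (Suc i) j" for i j
  have rows: "(\<Sum>j<M + 1. A i j * A k j) = (if i = k then c else 0)" if "i < M" "k < M" for i k
    using orthogonal_rowsD[OF B', of "Suc i" "Suc k"] that by (simp add: A_def)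
  hence rows': "(\<Sum>j<M + 1. real_of_int (A i j * A k j)) = (if i = k then real_of_int c else 0)"
    if "i < M" "k < M" for i k
    using that by (metis of_int_0 of_int_sum)
  have cols: "(\<Sum>i<M. (A i j)\<^sup>2) = c - d\<^sup>2" if j: "j < M + 1" for j
  proof -
    have "orthogonal_rows (M + 1) (M + 1) (\<lambda>_. rat_of_int c) (\<lambda>i j. of_int (B' i j))"
      by (rule orthogonal_rows_of_int[OF B'])
    hence "orthogonal_rows (M + 1) (M + 1) (\<lambda>_. rat_of_int c) (\<lambda>i j. of_int (B' j i))"
      by (rule orthogonal_rows_transpose) (use c in simp)
    from orthogonal_rowsD[OF this j j]
    have "(\<Sum>i<M + 1. rat_of_int (B' i j) * rat_of_int (B' i j)) = of_int c" by simp
    hence "rat_of_int (\<Sum>i<M + 1. B' i j * B' i j) = of_int c" by simp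
    hence "(\<Sum>i<Suc M. B' i j * B' i j) = c" by (simp only: of_int_eq_iff Suc_eq_plus1)
    thus ?thesis using row0[OF j] unfolding sum.lessThan_Suc_shift
      by (simp add: A_def power2_eq_square)
  qed
  have "has_rank_rows M (M + 1) A"
    unfolding has_rank_rows_def
  proof (intro allI impI)
    fix x :: "nat \<Rightarrow> real" and k
    assume x: "\<forall>j<M + 1. (\<Sum>i<M. x i * real_of_int (A i j)) = 0" and k: "k < M"
    have "orthogonal_rows M (M + 1) (\<lambda>_. real_of_int c) (\<lambda>i j. real_of_int (A i j))"
      using rows' by (simp add: orthogonal_rows_def)
    from orthogonal_rows_norm[OF this, of x] have "(\<Sum>i<M. real_of_int c * (x i)\<^sup>2) = 0"
      using x by simp
    hence "real_of_int c * (x k)\<^sup>2 = 0"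
      using k c by (subst (asm) sum_nonneg_eq_0_iff) auto
    thus "x k = 0" using c by simp
  qed
  hence "ENTIF M (M + 1) A"
    unfolding ENTIF_def using rows' cols c
    by (intro conjI exI[of _ "real_of_int c"]) simp_all
  thus ?thesis by blast
qed

lemma odd_square_mod_8:
  fixes x :: int
  assumes "odd x"
  shows "8 dvd x\<^sup>2 - 1"
proof -
  obtain y where x: "x = 2 * y + 1" using assms by (rule oddE)
  have "even (y * (y + 1))" by simp
  then obtain z where "y * (y + 1) = 2 * z" by blast
  hence "x\<^sup>2 - 1 = 8 * z" unfolding x by (simp add: power2_eq_square algebra_simps)
  thus ?thesis by simp
qed

lemma sum_of_odd_squares_mod_8:
  assumes "sum_of_odd_squares k n"
  shows "8 dvd int n - int k"
proof -
  obtain x :: "nat \<Rightarrow> int" where x: "\<forall>i<k. odd (x i)" "int n = (\<Sum>i<k. (x i)\<^sup>2)"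
    using assms unfolding sum_of_odd_squares_def by blast
  have "int n - int k = (\<Sum>i<k. (x i)\<^sup>2 - 1)" by (simp add: x(2) sum_subtractf)
  also have "8 dvd \<dots>" using x(1) by (intro dvd_sum odd_square_mod_8) auto
  finally show ?thesis .
qed

text \<open>Oddness makes \<open>M + 1\<close> congruent to \<open>k\<close> modulo 8, hence
  divisible by the block size, which is 1, 2, or, for \<open>k = 4\<close> and \<open>k = 8\<close>,
  4.\<close>

lemma ENTIF_if_sum_of_odd_squares:
  assumes M: "M \<ge> 1" and k: "k \<in> {1, 2, 4, 8}" and s: "sum_of_odd_squares k (M + 1)"
  shows "\<exists>A. ENTIF M (M + 1) A"
proof -
  have k8: "8 dvd int (M + 1) - int k" by (rule sum_of_odd_squares_mod_8[OF s])
  obtain x :: "nat \<Rightarrow> int" where x: "int (M + 1) = (\<Sum>i<k. (x i)\<^sup>2)"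
    using s unfolding sum_of_odd_squares_def by blast
  have "\<exists>B. orthogonal_rows (M + 1) (M + 1) (\<lambda>_. int (M + 1)) B"
  proof -
    consider "k = 1" | "k = 2" | "k = 4 \<or> k = 8" using k by blast
    thus ?thesis
    proof cases
      case 1
      hence "int (M + 1) = (x 0)\<^sup>2" using x by simp
      from orthogonal_rows_block[OF orthogonal_rows_one_square[OF this], of "M + 1"]
      show ?thesis unfolding mult_1 by blast
    next
      case 2
      hence "int (M + 1) = (x 0)\<^sup>2 + (x 1)\<^sup>2" using x by (simp add: sum_lessThan_2)
      note B = orthogonal_rows_block[OF orthogonal_rows_two_squares[OF this]]
      have "even (M + 1)" using 2 k8 by presburger
      then obtain m where m: "M + 1 = 2 * m" by blast
      show ?thesis using B[of m] unfolding m[symmetric] by blast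
    next
      case 3
      hence "4 dvd M + 1" using k8 by presburger
      then obtain m where m: "M + 1 = 4 * m" by blast
      show ?thesis using ex_orthogonal_rows_4_dvd[of m "M + 1"] unfolding m[symmetric] by metis
    qed
  qed
  thus ?thesis using ENTIF_if_orthogonal_rows[OF M] by blast
qed

section \<open>From frames to sums of odd squares\<close>

text \<open>Padding \<open>A\<close> with a zero row gives a singular square matrix, whose kernel
  supplies \<open>u\<close>.\<close>

lemma ex_nonzero_orthogonal_vector:
  fixes A :: "nat \<Rightarrow> nat \<Rightarrow> 'a::field"
  obtains u where "\<exists>j<M + 1. u j \<noteq> 0" "\<And>i. i < M \<Longrightarrow> (\<Sum>j<M + 1. A i j * u j) = 0"
proof -
  define P where "P = mat (M + 1) (M + 1) (\<lambda>(i, j). if i < M then A i j else 0)"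
  have P: "P \<in> carrier_mat (M + 1) (M + 1)" unfolding P_def by simp
  have "P\<^sup>T *\<^sub>v unit_vec (M + 1) M = 0\<^sub>v (M + 1)"
    by (rule eq_vecI) (auto simp: P_def)
  moreover have "unit_vec (M + 1) M \<noteq> (0\<^sub>v (M + 1) :: 'a vec)"
    by (metis index_unit_vec(1) index_zero_vec(1) less_add_one zero_neq_one)
  ultimately have "det P\<^sup>T = 0"
    using det_0_iff_vec_prod_zero_field[of "P\<^sup>T" "M + 1"] P
    by (metis transpose_carrier_mat unit_vec_carrier)
  hence "det P = 0" using det_transpose[OF P] by simp
  then obtain v where v: "v \<in> carrier_vec (M + 1)" "v \<noteq> 0\<^sub>v (M + 1)" "P *\<^sub>v v = 0\<^sub>v (M + 1)"
    using det_0_iff_vec_prod_zero_field[OF P] by blast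
  show ?thesis
  proof (rule that)
    show "\<exists>j<M + 1. v $ j \<noteq> 0"
    proof (rule ccontr)
      assume "\<not> ?thesis"
      hence "v = 0\<^sub>v (M + 1)" using v(1) by (intro eq_vecI) auto
      thus False using v(2) by simp
    qed
  next
    fix i assume i: "i < M"
    have "(P *\<^sub>v v) $ i = (\<Sum>j<M + 1. A i j * v $ j)"
      using i v(1) by (simp add: P_def scalar_prod_def atLeast0LessThan)
    thus "(\<Sum>j<M + 1. A i j * v $ j) = 0" using v(3) i by simp
  qed
qed

lemma orthogonal_rows_extend:
  fixes A :: "nat \<Rightarrow> nat \<Rightarrow> 'a::comm_ring_1"
  assumes "orthogonal_rows M n w A" "\<And>i. i < M \<Longrightarrow> (\<Sum>j<n. A i j * u j) = 0" "(\<Sum>j<n. u j * u j) = s"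
  shows "orthogonal_rows (M + 1) n (\<lambda>i. if i < M then w i else s) (\<lambda>i j. if i < M then A i j else u j)"
proof -
  have "(\<Sum>j<n. u j * A i j) = 0" if "i < M" for i using assms(2)[OF that] by (simp add: mult.commute)
  thus ?thesis using assms by (auto simp: orthogonal_rows_def less_Suc_eq)
qed

text \<open>With a kernel vector \<open>v\<close> of squared norm \<open>S\<close> as extra row, the
  column relations read \<open>c / lam + v j * v j / S = 1\<close>. So all \<open>v j\<close> agree
  up to sign, and division by a nonzero one gives entries 1 and -1.\<close>

lemma ENTIF_obtain_extension:
  assumes M: "M \<ge> 1" and A: "ENTIF M (M + 1) A"
  obtains lam :: rat and u :: "nat \<Rightarrow> rat" where "lam > 0"
    "orthogonal_rows M (M + 1) (\<lambda>_. lam) (\<lambda>i j. of_int (A i j))"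
    "\<forall>i<M. (\<Sum>j<M + 1. of_int (A i j) * u j) = 0"
    "(\<Sum>j<M + 1. u j * u j) = of_nat (M + 1)"
proof -
  obtain l :: real where l: "l > 0" and
    rows: "\<And>i k. i < M \<Longrightarrow> k < M \<Longrightarrow> (\<Sum>j<M + 1. real_of_int (A i j * A k j)) = (if i = k then l else 0)"
    using A unfolding ENTIF_def by blast
  \<comment> \<open>The real frame constant is the squared norm of row 0, hence an integer; this
    allows working over the rationals.\<close>
  define \<mu> where "\<mu> = (\<Sum>j<M + 1. A 0 j * A 0 j)"
  have l\<mu>: "l = real_of_int \<mu>" using rows[of 0 0] M unfolding \<mu>_def by simp
  have "orthogonal_rows M (M + 1) (\<lambda>_. \<mu>) A"
    unfolding orthogonal_rows_def
  proof (intro allI impI)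
    fix i k assume "i < M" "k < M"
    hence "real_of_int (\<Sum>j<M + 1. A i j * A k j) = real_of_int (if i = k then \<mu> else 0)"
      using rows[of i k] l\<mu> by simp
    thus "(\<Sum>j<M + 1. A i j * A k j) = (if i = k then \<mu> else 0)" by (simp only: of_int_eq_iff)
  qed
  from orthogonal_rows_of_int[OF this]
  have orth: "orthogonal_rows M (M + 1) (\<lambda>_. rat_of_int \<mu>) (\<lambda>i j. rat_of_int (A i j))" .
  define lam where "lam = rat_of_int \<mu>"
  have lam: "lam > 0" using l l\<mu> by (simp add: lam_def)
  note orth = orth[folded lam_def]
  define c where "c = (\<Sum>i<M. (A i 0)\<^sup>2)"
  have cols: "(\<Sum>i<M. (A i j)\<^sup>2) = c" if "j < M + 1" for j
    unfolding c_def
    by (rule A[unfolded ENTIF_def, THEN conjunct2, THEN conjunct2, rule_format]) (use that in simp_all)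
  obtain v where v: "\<exists>j<M + 1. v j \<noteq> 0" "\<And>i. i < M \<Longrightarrow> (\<Sum>j<M + 1. rat_of_int (A i j) * v j) = 0"
    using ex_nonzero_orthogonal_vector[where A = "\<lambda>i j. rat_of_int (A i j)"] by blast
  define S where "S = (\<Sum>j<M + 1. v j * v j)"
  obtain j0 where j0: "j0 < M + 1" "v j0 \<noteq> 0" using v(1) by blast
  have S: "S > 0"
    unfolding S_def using j0 by (intro sum_pos2[of _ j0]) (auto simp: zero_less_mult_iff)
  note ext = orthogonal_rows_extend[OF orth v(2) S_def[symmetric]]
  have vv: "v j * v j = S * (1 - of_int c / lam)" if j: "j < M + 1" for j
  proof -
    have "(\<Sum>i<M. rat_of_int (A i j) * rat_of_int (A i j) / lam) + v j * v j / S = 1"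
      using orthogonal_rows_imp_columns[OF ext _ j j] lam S by simp
    moreover have "(\<Sum>i<M. rat_of_int (A i j) * rat_of_int (A i j) / lam) = of_int (\<Sum>i<M. (A i j)\<^sup>2) / lam"
      by (simp add: sum_divide_distrib power2_eq_square)
    ultimately have "of_int c / lam + v j * v j / S = 1" unfolding cols[OF j] by simp
    thus ?thesis using S lam by (simp add: field_simps)
  qed
  define u where "u j = v j / v j0" for j
  have "u j * u j = 1" if "j < M + 1" for j
  proof -
    have "v j * v j = v j0 * v j0" using vv[OF that] vv[OF j0(1)] by (simp only:)
    thus ?thesis using j0(2) by (simp add: u_def)
  qed
  hence uu: "(\<Sum>j<M + 1. u j * u j) = of_nat (M + 1)" by simp
  have ker: "(\<Sum>j<M + 1. rat_of_int (A i j) * u j) = 0" if "i < M" for i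
  proof -
    have "(\<Sum>j<M + 1. rat_of_int (A i j) * u j) = (\<Sum>j<M + 1. rat_of_int (A i j) * v j) / v j0"
      unfolding sum_divide_distrib by (simp add: u_def)
    thus ?thesis using v(2)[OF that] by simp
  qed
  show ?thesis using that lam orth ker uu by blast
qed

lemma ENTIF_imp_sum_of_odd_squares:
  assumes M: "M \<ge> 1" and A: "ENTIF M (M + 1) A"
  shows "\<exists>k \<in> {1, 2, 4, 8}. sum_of_odd_squares k (M + 1)"
proof -
  obtain lam :: rat and u :: "nat \<Rightarrow> rat" where lam: "lam > 0"
    and orth: "orthogonal_rows M (M + 1) (\<lambda>_. lam) (\<lambda>i j. of_int (A i j))"
    and ker: "\<forall>i<M. (\<Sum>j<M + 1. of_int (A i j) * u j) = 0"
    and uu: "(\<Sum>j<M + 1. u j * u j) = of_nat (M + 1)"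
    using ENTIF_obtain_extension[OF M A] .
  define D where "D = det (mat (M + 1) (M + 1) (\<lambda>(i, j). if i < M then of_int (A i j) else u j))"
  have "D\<^sup>2 = (\<Prod>i<M + 1. if i < M then lam else of_nat (M + 1))"
    unfolding D_def by (rule orthogonal_rows_det[OF orthogonal_rows_extend[OF orth ker[rule_format] uu]])
  hence D: "D\<^sup>2 = lam ^ M * of_nat (M + 1)" by simp
  have "odd (M + 1) \<or> (M + 1) mod 4 = 2 \<or> (M + 1) mod 8 = 4 \<or> (M + 1) mod 8 = 0" by presburger
  thus ?thesis
  proof (elim disjE)
    assume 1: "odd (M + 1)"
    then obtain h where h: "M = 2 * h" by auto
    \<comment> \<open>\<open>M\<close> is even, so \<open>lam ^ M\<close> is a square and can be
      divided out of \<open>D\<^sup>2\<close>.\<close>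
    have "of_int (int (M + 1)) = (D / lam ^ h)\<^sup>2"
      using D lam by (simp add: h power_divide power_mult[symmetric] mult.commute)
    then obtain z where z: "int (M + 1) = z\<^sup>2" using rational_square_imp_int_square by blast
    have "odd z" using 1 z by (metis even_of_nat even_power zero_less_numeral)
    hence "sum_of_odd_squares 1 (M + 1)"
      unfolding sum_of_odd_squares_def using z by (intro exI[of _ "\<lambda>_. z"]) simp
    thus ?thesis by blast
  next
    assume 2: "(M + 1) mod 4 = 2"
    define k where "k = (M + 1) div 4"
    have k: "M + 1 = 4 * k + 2" using 2 unfolding k_def by presburger
    hence M': "M = 2 * (2 * k) + 1" by simp
    define t where "t = D / lam ^ (2 * k)"
    have "lam ^ M = (lam ^ (2 * k))\<^sup>2 * lam"
      unfolding M' by (simp add: power_mult[symmetric] mult.commute)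
    hence t: "t\<^sup>2 = lam * of_nat (M + 1)" using D lam by (simp add: t_def power_divide)
    \<comment> \<open>The scaling that turns row norm \<open>lam\<close> into \<open>M + 1\<close>,
      the norm of \<open>u\<close>; it is rational because \<open>lam * of_nat (M + 1)\<close> is
      the square of \<open>t\<close>.\<close>
    define q where "q = of_nat (M + 1) / t"
    have "q\<^sup>2 * lam = (of_nat (M + 1))\<^sup>2 * lam / (lam * of_nat (M + 1))"
      unfolding t[symmetric] by (simp add: q_def power_divide)
    hence q: "q\<^sup>2 * lam = of_nat (M + 1)"
      using lam by (simp add: power2_eq_square del: of_nat_add)
    have C: "orthogonal_rows M (M + 1) (\<lambda>_. of_nat (M + 1)) (\<lambda>i j. q * of_int (A i j))"
      unfolding orthogonal_rows_def
    proof (intro allI impI)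
      fix i k assume "i < M" "k < M"
      have "(\<Sum>j<M + 1. q * of_int (A i j) * (q * of_int (A k j))) =
          q\<^sup>2 * (\<Sum>j<M + 1. of_int (A i j) * of_int (A k j))"
        unfolding sum_distrib_left by (intro sum.cong refl) (simp add: power2_eq_square)
      also have "\<dots> = (if i = k then of_nat (M + 1) else 0)"
        unfolding orthogonal_rowsD[OF orth \<open>i < M\<close> \<open>k < M\<close>] using q by simp
      finally show "(\<Sum>j<M + 1. q * of_int (A i j) * (q * of_int (A k j))) =
        (if i = k then of_nat (M + 1) else 0)" .
    qed
    have Cu: "(\<Sum>j<M + 1. q * of_int (A i j) * u j) = 0" if "i < M" for i
    proof -
      have "(\<Sum>j<M + 1. q * of_int (A i j) * u j) = q * (\<Sum>j<M + 1. of_int (A i j) * u j)"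
        unfolding sum_distrib_left by (simp add: mult.assoc)
      thus ?thesis using ker that by simp
    qed
    have "orthogonal_rows (M + 1) (M + 1) (\<lambda>_. of_nat (M + 1))
        (\<lambda>i j. if i < M then q * of_int (A i j) else u j)"
      using orthogonal_rows_extend[OF C Cu uu] by (simp only: if_cancel)
    then obtain a b :: rat where "of_nat (M + 1) = a\<^sup>2 + b\<^sup>2"
      using orthogonal_rows_imp_two_rational_squares k by blast
    hence "of_int (int (M + 1)) = a\<^sup>2 + b\<^sup>2" by simp
    then obtain x y :: int where xy: "int (M + 1) = x\<^sup>2 + y\<^sup>2"
      using rational_two_squares_imp_int_two_squares by blast
    \<comment> \<open>Since the sum is even, one even root forces both to be even, and then 4 would
      divide \<open>M + 1\<close>.\<close>
    have "odd x \<and> odd y"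
    proof (rule ccontr)
      assume *: "\<not> (odd x \<and> odd y)"
      have "even (x\<^sup>2 + y\<^sup>2)" unfolding xy[symmetric] using k by presburger
      hence "even x" "even y" using * by auto
      hence "2\<^sup>2 dvd x\<^sup>2" "2\<^sup>2 dvd y\<^sup>2" by (auto simp only: dvd_power_same)
      hence "4 dvd int (M + 1)" unfolding xy by simp
      thus False using k by presburger
    qed
    hence "sum_of_odd_squares 2 (M + 1)"
      unfolding sum_of_odd_squares_def using xy
      by (intro exI[of _ "\<lambda>i. if i = 0 then x else y"]) (simp add: sum_lessThan_2)
    thus ?thesis by blast
  next
    assume 3: "(M + 1) mod 8 = 4"
    define m where "m = (M + 1) div 4"
    have "M + 1 = 4 * m" "odd m" using 3 unfolding m_def by presburger+
    thus ?thesis using sum_of_odd_squares_4[of m] by auto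
  next
    assume "(M + 1) mod 8 = 0"
    then obtain m where "M + 1 = 8 * m" by (auto simp: mod_eq_0_iff_dvd)
    thus ?thesis using sum_of_odd_squares_8[of m] by auto
  qed
qed

theorem theorem5p4:
  fixes M :: nat
  assumes "M \<ge> 1"
  shows "(\<exists>A. ENTIF M (M + 1) A) \<longleftrightarrow>
         (\<exists>k \<in> {1, 2, 4, 8}. sum_of_odd_squares k (M + 1))"
  using ENTIF_imp_sum_of_odd_squares[OF assms] ENTIF_if_sum_of_odd_squares[OF assms] by blast

end
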